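(* Let $(K,\nu,\Gamma)$ be a valued field with valuation ring $R$, let $\gamma\in\Gamma$ with $\gamma\ge0$, and let $a,b,a_0,\dots,a_k\in K$. Then: (1) $\bigcup[a]_\gamma=a(1+\mathfrak m^\gamma)=\{x\in K:\nu(x-a)>\gamma+\nu(a)\}$. (2) $\bigcup([a]_\gamma+_{\mathcal H}[b]_\gamma)=\{x\in K:\nu(x-(a+b))>\gamma+\min\{\nu(a),\nu(b)\}\}$. (3) $0\in\bigcup([a]_\gamma+_{\mathcal H}[b]_\gamma)$ if and only if $\bigcup([a]_\gamma+_{\mathcal H}[b]_\gamma)=\mathfrak m^{\gamma+\min\{\nu(a),\nu(b)\}}$. (4) $[a_0+\cdots+a_k]_\gamma\in\sum^{\mathcal H}[a_i]_\gamma$. (5) Suppose $a_0,\dots,a_k\in R$ and $b\in\bigcup\sum^{\mathcal H}[a_i]_\gamma$. Then $b=(a_0+\cdots+a_k)+d$ for some $d\in\mathfrak m^\gamma$.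
   Context: For $\delta\in\Gamma$, $\mathfrak m^\delta=\{x\in K:\nu(x)>\delta\}$. The statement $\nu(x)>\infty$ is read as $x=0$, so $\mathfrak m^\infty=\{0\}$. For $\gamma\ge0$, $\mathcal H_\gamma(K)=K/(1+\mathfrak m^\gamma)$ is the set of classes $[x]_\gamma=x(1+\mathfrak m^\gamma)$, with multivalued addition $[a]_\gamma+_{\mathcal H}[b]_\gamma=\{[x+y]_\gamma:x\in[a]_\gamma,\ y\in[b]_\gamma\}$, a set of classes; this operation is associative. $\sum^{\mathcal H}[a_i]_\gamma\subseteq\mathcal H_\gamma(K)$ denotes the iterated sum $[a_0]_\gamma+_{\mathcal H}\cdots+_{\mathcal H}[a_k]_\gamma$, where $\alpha+B=\bigcup_{\beta\in B}(\alpha+\beta)$. For a set $A$ of classes, $\bigcup A\subseteq K$ is the union of the classes in $A$ (and $\bigcup[a]_\gamma$ is the class $[a]_\gamma$ regarded as a subset of $K$). *)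

theory Defs
  imports Main
begin

text \<open>The ordered monoid \<open>\<Gamma> \<union> {\<infinity>}\<close> of an ordered abelian group \<open>\<Gamma>\<close>, with \<open>\<infinity>\<close> above
  every element of \<open>\<Gamma>\<close> and absorbing for addition.\<close>

datatype 'g with_infty = Fin 'g | Infty

instantiation with_infty :: (linorder) linorder
begin

fun less_eq_with_infty :: "'a with_infty \<Rightarrow> 'a with_infty \<Rightarrow> bool" where
  "less_eq_with_infty _ Infty \<longleftrightarrow> True"
| "less_eq_with_infty Infty (Fin _) \<longleftrightarrow> False"
| "less_eq_with_infty (Fin g) (Fin h) \<longleftrightarrow> g \<le> h"

fun less_with_infty :: "'a with_infty \<Rightarrow> 'a with_infty \<Rightarrow> bool" where
  "less_with_infty Infty _ \<longleftrightarrow> False"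
| "less_with_infty (Fin _) Infty \<longleftrightarrow> True"
| "less_with_infty (Fin g) (Fin h) \<longleftrightarrow> g < h"

instance
proof
  fix x y z :: "'a with_infty"
  show "x < y \<longleftrightarrow> x \<le> y \<and> \<not> y \<le> x" by (cases x; cases y) auto
  show "x \<le> x" by (cases x) auto
  show "x \<le> y \<Longrightarrow> y \<le> z \<Longrightarrow> x \<le> z" by (cases x; cases y; cases z) auto
  show "x \<le> y \<Longrightarrow> y \<le> x \<Longrightarrow> x = y" by (cases x; cases y) auto
  show "x \<le> y \<or> y \<le> x" by (cases x; cases y) auto
qed

end

instantiation with_infty :: (comm_monoid_add) comm_monoid_add
begin

definition zero_with_infty :: "'a with_infty" where
  "0 = Fin 0"

fun plus_with_infty :: "'a with_infty \<Rightarrow> 'a with_infty \<Rightarrow> 'a with_infty" where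
  "plus_with_infty (Fin g) (Fin h) = Fin (g + h)"
| "plus_with_infty Infty _ = Infty"
| "plus_with_infty _ Infty = Infty"

instance
proof
  fix x y z :: "'a with_infty"
  show "x + y + z = x + (y + z)" by (cases x; cases y; cases z) (auto simp: add.assoc)
  show "x + y = y + x" by (cases x; cases y) (auto simp: add.commute)
  show "0 + x = x" by (cases x) (auto simp: zero_with_infty_def)
qed

end

text \<open>Surjectivity onto the value group is not required.\<close>

definition valuation :: "('k::field \<Rightarrow> 'g::linordered_ab_group_add with_infty) \<Rightarrow> bool" where
  "valuation \<nu> \<longleftrightarrow>
     (\<forall>x. \<nu> x = Infty \<longleftrightarrow> x = 0) \<and>
     (\<forall>x y. \<nu> (x * y) = \<nu> x + \<nu> y) \<and>
     (\<forall>x y. \<nu> (x + y) \<ge> min (\<nu> x) (\<nu> y))"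

definition valuation_ring :: "('k::field \<Rightarrow> 'g::linordered_ab_group_add with_infty) \<Rightarrow> 'k set" where
  "valuation_ring \<nu> = {x. \<nu> x \<ge> 0}"

text \<open>The relation \<open>\<nu>(x) > \<delta>\<close>, where \<open>\<nu>(x) > \<infinity>\<close> is by convention read as \<open>x = 0\<close>
  (whereas \<open>Infty < \<nu> x\<close> is always false).\<close>

definition val_gt :: "('k::field \<Rightarrow> 'g::linordered_ab_group_add with_infty) \<Rightarrow> 'k \<Rightarrow> 'g with_infty \<Rightarrow> bool" where
  "val_gt \<nu> x \<delta> \<longleftrightarrow> (case \<delta> of Fin _ \<Rightarrow> \<nu> x > \<delta> | Infty \<Rightarrow> x = 0)"

definition m_ideal :: "('k::field \<Rightarrow> 'g::linordered_ab_group_add with_infty) \<Rightarrow> 'g with_infty \<Rightarrow> 'k set" where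
  "m_ideal \<nu> \<delta> = {x. val_gt \<nu> x \<delta>}"

text \<open>The class \<open>[x]\<^sub>\<gamma> = x(1 + \<mm>\<^sup>\<gamma>)\<close>. A class is represented as a subset of the field, so that
  \<open>\<Union>[x]\<^sub>\<gamma>\<close> is \<open>hclass \<nu> \<gamma> x\<close> itself, and a set of classes has type \<^typ>\<open>'k set set\<close>.\<close>

definition hclass :: "('k::field \<Rightarrow> 'g::linordered_ab_group_add with_infty) \<Rightarrow> 'g \<Rightarrow> 'k \<Rightarrow> 'k set" where
  "hclass \<nu> \<gamma> x = {x * (1 + u) | u. u \<in> m_ideal \<nu> (Fin \<gamma>)}"

definition hadd :: "('k::field \<Rightarrow> 'g::linordered_ab_group_add with_infty) \<Rightarrow> 'g \<Rightarrow> 'k set \<Rightarrow> 'k set \<Rightarrow> 'k set set" where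
  "hadd \<nu> \<gamma> A B = {hclass \<nu> \<gamma> (x + y) | x y. x \<in> A \<and> y \<in> B}"

text \<open>\<open>hsum \<nu> \<gamma> c k\<close> is the iterated sum \<open>c 0 + (c 1 + (\<dots> + c k))\<close> of the classes
  \<open>c 0, \<dots>, c k\<close>.\<close>

primrec hsum :: "('k::field \<Rightarrow> 'g::linordered_ab_group_add with_infty) \<Rightarrow> 'g \<Rightarrow> (nat \<Rightarrow> 'k set) \<Rightarrow> nat \<Rightarrow> 'k set set" where
  "hsum \<nu> \<gamma> c 0 = {c 0}"
| "hsum \<nu> \<gamma> c (Suc k) = (\<Union>\<beta>\<in>hsum \<nu> \<gamma> (\<lambda>i. c (Suc i)) k. hadd \<nu> \<gamma> (c 0) \<beta>)"

end

theory Submission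
  imports Defs
begin

text \<open>
  The class \<open>[a]\<^sub>\<gamma>\<close> is an ultrametric ball whose size is proportional to its centre: for
  \<open>a \<noteq> 0\<close>, the conditions \<open>\<nu>(u) > \<gamma>\<close> and \<open>\<nu>(au) > \<gamma> + \<nu>(a)\<close> are equivalent
  (lemma \<open>mem_hclass_iff\<close>). The set \<open>\<mm>\<^sup>\<delta>\<close> is an additive subgroup of \<open>K\<close> that shrinks as
  \<open>\<delta>\<close> grows, so everything else is computation with cosets of such subgroups.

  Call \<open>x\<close> an approximation of \<open>a\<close> at level \<open>\<delta>\<close> if \<open>x - a \<in> \<mm>\<^bsup>\<gamma>+\<delta>\<^esup>\<close>. When \<open>\<nu>(a) \<ge> \<delta>\<close>
  and \<open>\<gamma> \<ge> 0\<close>, such an \<open>x\<close> also satisfies \<open>\<nu>(x) \<ge> \<delta>\<close>. Hence if \<open>x\<close> and \<open>y\<close> approximate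
  \<open>a\<close> and \<open>b\<close> at level \<open>\<delta>\<close>, then \<open>\<nu>(x + y) \<ge> \<delta>\<close>, so that all of \<open>[x + y]\<^sub>\<gamma>\<close> approximates
  \<open>a + b\<close> at the same level \<open>\<delta>\<close> (lemma \<open>hclass_add_approx\<close>). With \<open>\<delta> = min(\<nu>(a), \<nu>(b))\<close>
  this bounds the sum of two classes. Conversely, any \<open>z\<close> in the resulting ball can be
  written as \<open>(z - b) + b\<close> or \<open>a + (z - a)\<close>, where the whole error is charged to the summand
  of smaller value, whose class is the larger ball (lemma \<open>Union_hadd_hclass\<close>). The
  criterion for \<open>0\<close> says that a coset of a subgroup contains \<open>0\<close> exactly when it is that subgroup.

  Because the level is preserved, the estimate iterates without loss
  (lemma \<open>hsum_approx\<close>); for summands in the valuation ring the level is \<open>0\<close>, and the total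
  error lies in \<open>\<mm>\<^sup>\<gamma>\<close>.
\<close>

lemma with_infty_le_Infty [simp]: "x \<le> Infty"
  by (cases x) auto

lemma le_Fin_plus:
  fixes \<delta> :: "'g::linordered_ab_group_add with_infty"
  assumes "0 \<le> \<gamma>"
  shows "\<delta> \<le> Fin \<gamma> + \<delta>"
  using assms by (cases \<delta>) auto

lemma Fin_plus_mono:
  fixes \<delta> \<delta>' :: "'g::linordered_ab_group_add with_infty"
  assumes "\<delta> \<le> \<delta>'"
  shows "Fin \<gamma> + \<delta> \<le> Fin \<gamma> + \<delta>'"
  using assms by (cases \<delta>; cases \<delta>') auto

locale valued_field =
  fixes \<nu> :: "'k::field \<Rightarrow> 'g::linordered_ab_group_add with_infty"
  assumes valuation: "valuation \<nu>"
begin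

lemma val_eq_Infty_iff [simp]: "\<nu> x = Infty \<longleftrightarrow> x = 0"
  and val_mult: "\<nu> (x * y) = \<nu> x + \<nu> y"
  and val_add: "min (\<nu> x) (\<nu> y) \<le> \<nu> (x + y)"
  using valuation unfolding valuation_def by auto

lemma val_0 [simp]: "\<nu> 0 = Infty"
  by simp

lemma val_add_ge:
  assumes "\<delta> \<le> \<nu> x" and "\<delta> \<le> \<nu> y"
  shows "\<delta> \<le> \<nu> (x + y)"
  using assms val_add[of x y] by (meson min.boundedI order_trans)

lemma val_add_gt:
  assumes "\<delta> < \<nu> x" and "\<delta> < \<nu> y"
  shows "\<delta> < \<nu> (x + y)"
  using assms val_add[of x y] by (meson less_le_trans min_less_iff_conj)

text \<open>The values of \<open>1\<close> and \<open>-1\<close> are \<open>0\<close> since \<open>\<Gamma>\<close> has no idempotents other than \<open>0\<close> and,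
  being ordered, no \<open>2\<close>-torsion.\<close>

lemma val_minus [simp]: "\<nu> (- x) = \<nu> x"
proof -
  obtain g where g: "\<nu> 1 = Fin g"
    by (cases "\<nu> 1") auto
  obtain h where h: "\<nu> (- 1) = Fin h"
    by (cases "\<nu> (- 1)") auto
  have "g = 0"
    using val_mult[of 1 1] g by simp
  moreover have "h + h = g"
    using val_mult[of "- 1" "- 1"] g h by simp
  ultimately have "h = 0"
    by simp
  then have "\<nu> (- 1) = 0"
    using h by (simp add: zero_with_infty_def)
  then show ?thesis
    using val_mult[of "- 1" x] by simp
qed

lemma mem_m_ideal_Fin [simp]: "x \<in> m_ideal \<nu> (Fin d) \<longleftrightarrow> Fin d < \<nu> x"
  and mem_m_ideal_Infty [simp]: "x \<in> m_ideal \<nu> Infty \<longleftrightarrow> x = 0"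
  by (simp_all add: m_ideal_def val_gt_def)

lemma m_ideal_0 [simp]: "0 \<in> m_ideal \<nu> \<delta>"
  by (cases \<delta>) auto

lemma m_ideal_add:
  assumes "x \<in> m_ideal \<nu> \<delta>" and "y \<in> m_ideal \<nu> \<delta>"
  shows "x + y \<in> m_ideal \<nu> \<delta>"
  using assms by (cases \<delta>) (auto intro: val_add_gt)

lemma m_ideal_minus:
  assumes "x \<in> m_ideal \<nu> \<delta>"
  shows "- x \<in> m_ideal \<nu> \<delta>"
  using assms by (cases \<delta>) auto

lemma m_ideal_diff:
  assumes "x \<in> m_ideal \<nu> \<delta>" and "y \<in> m_ideal \<nu> \<delta>"
  shows "x - y \<in> m_ideal \<nu> \<delta>"
  using m_ideal_add[OF assms(1) m_ideal_minus[OF assms(2)]] by simp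

lemma m_ideal_imp_val_ge:
  assumes "x \<in> m_ideal \<nu> \<delta>"
  shows "\<delta> \<le> \<nu> x"
  using assms by (cases \<delta>) auto

lemma m_ideal_antimono:
  assumes "\<delta> \<le> \<delta>'" and "x \<in> m_ideal \<nu> \<delta>'"
  shows "x \<in> m_ideal \<nu> \<delta>"
proof (cases \<delta>')
  case (Fin d')
  then obtain d where "\<delta> = Fin d"
    using assms(1) by (cases \<delta>) auto
  then show ?thesis
    using Fin assms le_less_trans[of \<delta> \<delta>' "\<nu> x"] by simp
next
  case Infty
  then show ?thesis
    using assms(2) by simp
qed

text \<open>Writing \<open>x = a(1 + u)\<close> means \<open>x - a = au\<close>, and \<open>\<nu>(au) = \<nu>(a) + \<nu>(u)\<close>. For \<open>a = 0\<close> both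
  sides force \<open>x = 0\<close>, by the convention for \<open>\<mm>\<^sup>\<infinity>\<close>.\<close>

lemma mem_hclass_iff: "x \<in> hclass \<nu> \<gamma> a \<longleftrightarrow> x - a \<in> m_ideal \<nu> (Fin \<gamma> + \<nu> a)"
proof (cases "a = 0")
  case True
  obtain u where "u \<in> m_ideal \<nu> (Fin \<gamma>)"
    using m_ideal_0 by blast
  then show ?thesis
    using True by (auto simp: hclass_def)
next
  case False
  then obtain g where g: "\<nu> a = Fin g"
    by (cases "\<nu> a") auto
  have scale: "a * u \<in> m_ideal \<nu> (Fin \<gamma> + \<nu> a) \<longleftrightarrow> u \<in> m_ideal \<nu> (Fin \<gamma>)" for u
    by (cases "\<nu> u") (auto simp: val_mult g add.commute[of g])
  show ?thesis
  proof
    assume "x \<in> hclass \<nu> \<gamma> a"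
    then obtain u where u: "u \<in> m_ideal \<nu> (Fin \<gamma>)" "x = a * (1 + u)"
      unfolding hclass_def by blast
    then have "x - a = a * u"
      by (simp add: distrib_left)
    then show "x - a \<in> m_ideal \<nu> (Fin \<gamma> + \<nu> a)"
      using scale u(1) by simp
  next
    assume *: "x - a \<in> m_ideal \<nu> (Fin \<gamma> + \<nu> a)"
    have "a * ((x - a) / a) = x - a" and "x = a * (1 + (x - a) / a)"
      using False by (simp_all add: distrib_left)
    then show "x \<in> hclass \<nu> \<gamma> a"
      using * scale[of "(x - a) / a"] unfolding hclass_def by auto
  qed
qed

lemma hclass_refl: "a \<in> hclass \<nu> \<gamma> a"
  by (simp add: mem_hclass_iff)

lemma hclass_approx:
  assumes "\<delta> \<le> \<nu> a" and "x \<in> hclass \<nu> \<gamma> a"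
  shows "x - a \<in> m_ideal \<nu> (Fin \<gamma> + \<delta>)"
  using assms m_ideal_antimono[OF Fin_plus_mono] by (simp add: mem_hclass_iff)

lemma approx_imp_val_ge:
  assumes "0 \<le> \<gamma>" and "\<delta> \<le> \<nu> a" and "x - a \<in> m_ideal \<nu> (Fin \<gamma> + \<delta>)"
  shows "\<delta> \<le> \<nu> x"
proof -
  have "\<delta> \<le> \<nu> (x - a)"
    using le_Fin_plus[OF assms(1)] m_ideal_imp_val_ge[OF assms(3)] by (rule order_trans)
  then show ?thesis
    using val_add_ge[OF assms(2), of "x - a"] by simp
qed

text \<open>The key estimate: passing from \<open>x + y\<close> to another element of its class costs an error
  of value above \<open>\<gamma> + \<nu>(x + y) \<ge> \<gamma> + \<delta>\<close>, which is no worse than the errors already present in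
  \<open>x\<close> and \<open>y\<close>. The bound is stated for any common lower bound \<open>\<delta>\<close>, so that it can be
  iterated with one fixed level.\<close>

lemma hclass_add_approx:
  assumes "0 \<le> \<gamma>"
    and "\<delta> \<le> \<nu> a" and x: "x - a \<in> m_ideal \<nu> (Fin \<gamma> + \<delta>)"
    and "\<delta> \<le> \<nu> b" and y: "y - b \<in> m_ideal \<nu> (Fin \<gamma> + \<delta>)"
    and z: "z \<in> hclass \<nu> \<gamma> (x + y)"
  shows "z - (a + b) \<in> m_ideal \<nu> (Fin \<gamma> + \<delta>)"
proof -
  have "\<delta> \<le> \<nu> (x + y)"
    using val_add_ge[OF approx_imp_val_ge[OF assms(1,2) x] approx_imp_val_ge[OF assms(1,4) y]] .
  then have "z - (x + y) \<in> m_ideal \<nu> (Fin \<gamma> + \<delta>)"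
    using z by (rule hclass_approx)
  then have "(z - (x + y)) + ((x - a) + (y - b)) \<in> m_ideal \<nu> (Fin \<gamma> + \<delta>)"
    using x y by (intro m_ideal_add)
  then show ?thesis
    by (simp add: algebra_simps)
qed

lemma hadd_commute: "hadd \<nu> \<gamma> A B = hadd \<nu> \<gamma> B A"
proof -
  have "hadd \<nu> \<gamma> A B \<subseteq> hadd \<nu> \<gamma> B A" for A B
  proof
    fix C assume "C \<in> hadd \<nu> \<gamma> A B"
    then obtain x y where "C = hclass \<nu> \<gamma> (y + x)" "x \<in> A" "y \<in> B"
      unfolding hadd_def by (auto simp: add.commute)
    then show "C \<in> hadd \<nu> \<gamma> B A"
      unfolding hadd_def by blast
  qed
  then show ?thesis
    by blast
qed

lemma ball_subset_Union_hadd: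
  assumes "\<nu> a \<le> \<nu> b" and "z - (a + b) \<in> m_ideal \<nu> (Fin \<gamma> + \<nu> a)"
  shows "z \<in> \<Union> (hadd \<nu> \<gamma> (hclass \<nu> \<gamma> a) (hclass \<nu> \<gamma> b))"
proof -
  \<comment> \<open>The class of \<open>a\<close> is the larger ball, so it absorbs the error while \<open>b\<close> is kept exact.\<close>
  have "z - b \<in> hclass \<nu> \<gamma> a"
    using assms(2) by (simp add: mem_hclass_iff algebra_simps)
  moreover have "z \<in> hclass \<nu> \<gamma> ((z - b) + b)"
    by (simp add: hclass_refl)
  ultimately show ?thesis
    using hclass_refl[of b \<gamma>] unfolding hadd_def by blast
qed

lemma Union_hadd_hclass:
  assumes "0 \<le> \<gamma>"
  shows "\<Union> (hadd \<nu> \<gamma> (hclass \<nu> \<gamma> a) (hclass \<nu> \<gamma> b))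
    = {z. z - (a + b) \<in> m_ideal \<nu> (Fin \<gamma> + min (\<nu> a) (\<nu> b))}" (is "?S = ?B")
proof
  show "?S \<subseteq> ?B"
  proof
    fix z assume "z \<in> ?S"
    then obtain x y where xy: "x \<in> hclass \<nu> \<gamma> a" "y \<in> hclass \<nu> \<gamma> b" "z \<in> hclass \<nu> \<gamma> (x + y)"
      unfolding hadd_def by blast
    have "min (\<nu> a) (\<nu> b) \<le> \<nu> a" and "min (\<nu> a) (\<nu> b) \<le> \<nu> b"
      by simp_all
    then show "z \<in> ?B"
      using hclass_add_approx[OF assms] hclass_approx xy by blast
  qed
  show "?B \<subseteq> ?S"
  proof
    fix z assume z: "z \<in> ?B"
    show "z \<in> ?S"
    proof (cases "\<nu> a \<le> \<nu> b")
      case True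
      then show ?thesis
        using z ball_subset_Union_hadd[of a b z] by (simp add: min_def)
    next
      case False
      then show ?thesis
        using z ball_subset_Union_hadd[of b a z \<gamma>]
        unfolding hadd_commute[of \<gamma> "hclass \<nu> \<gamma> b"] by (simp add: min_def add.commute[of b])
    qed
  qed
qed

lemma zero_mem_coset_m_ideal_iff:
  "0 \<in> {z. z - c \<in> m_ideal \<nu> \<delta>} \<longleftrightarrow> {z. z - c \<in> m_ideal \<nu> \<delta>} = m_ideal \<nu> \<delta>"
proof
  assume "0 \<in> {z. z - c \<in> m_ideal \<nu> \<delta>}"
  then have c: "c \<in> m_ideal \<nu> \<delta>"
    using m_ideal_minus[of "- c"] by simp
  have "z - c \<in> m_ideal \<nu> \<delta> \<longleftrightarrow> z \<in> m_ideal \<nu> \<delta>" for z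
    using m_ideal_add[OF _ c, of "z - c"] m_ideal_diff[OF _ c, of z] by auto
  then show "{z. z - c \<in> m_ideal \<nu> \<delta>} = m_ideal \<nu> \<delta>"
    by blast
next
  assume "{z. z - c \<in> m_ideal \<nu> \<delta>} = m_ideal \<nu> \<delta>"
  then show "0 \<in> {z. z - c \<in> m_ideal \<nu> \<delta>}"
    using m_ideal_0 by blast
qed

text \<open>At each stage the exact representatives \<open>a\<^sub>0\<close> and \<open>a\<^sub>1 + \<dots> + a\<^sub>k\<close> may be chosen in the
  two classes being added.\<close>

lemma hclass_sum_mem_hsum:
  "hclass \<nu> \<gamma> (\<Sum>i\<le>k. as i) \<in> hsum \<nu> \<gamma> (\<lambda>i. hclass \<nu> \<gamma> (as i)) k"
proof (induction k arbitrary: as)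
  case 0
  then show ?case by simp
next
  case (Suc k)
  let ?s = "\<Sum>i\<le>k. as (Suc i)"
  have "hclass \<nu> \<gamma> (as 0 + ?s) \<in> hadd \<nu> \<gamma> (hclass \<nu> \<gamma> (as 0)) (hclass \<nu> \<gamma> ?s)"
    unfolding hadd_def using hclass_refl by blast
  then show ?case
    using Suc.IH[of "\<lambda>i. as (Suc i)"] by (auto simp: sum.atMost_Suc_shift simp del: sum.atMost_Suc)
qed

lemma val_sum_ge:
  assumes "\<And>i. i \<le> (k::nat) \<Longrightarrow> \<delta> \<le> \<nu> (as i)"
  shows "\<delta> \<le> \<nu> (\<Sum>i\<le>k. as i)"
  using assms by (induction k) (auto intro: val_add_ge)

lemma hsum_approx:
  assumes "0 \<le> \<gamma>" and "\<And>i. i \<le> k \<Longrightarrow> \<delta> \<le> \<nu> (as i)"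
    and "z \<in> \<Union> (hsum \<nu> \<gamma> (\<lambda>i. hclass \<nu> \<gamma> (as i)) k)"
  shows "z - (\<Sum>i\<le>k. as i) \<in> m_ideal \<nu> (Fin \<gamma> + \<delta>)"
  using assms(2,3)
proof (induction k arbitrary: as z)
  case 0
  then show ?case
    using hclass_approx by auto
next
  case (Suc k)
  let ?s = "\<Sum>i\<le>k. as (Suc i)"
  obtain \<beta> x y where \<beta>: "\<beta> \<in> hsum \<nu> \<gamma> (\<lambda>i. hclass \<nu> \<gamma> (as (Suc i))) k" "y \<in> \<beta>"
    and x: "x \<in> hclass \<nu> \<gamma> (as 0)" and z: "z \<in> hclass \<nu> \<gamma> (x + y)"
    using Suc.prems(2) by (auto simp: hadd_def)
  have a0: "\<delta> \<le> \<nu> (as 0)" and tail: "\<And>i. i \<le> k \<Longrightarrow> \<delta> \<le> \<nu> (as (Suc i))"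
    using Suc.prems(1) by simp_all
  have y: "y - ?s \<in> m_ideal \<nu> (Fin \<gamma> + \<delta>)"
    using Suc.IH[of "\<lambda>i. as (Suc i)" y, OF tail] \<beta> by blast
  have "z - (as 0 + ?s) \<in> m_ideal \<nu> (Fin \<gamma> + \<delta>)"
    using hclass_add_approx[OF assms(1) a0 hclass_approx[OF a0 x] val_sum_ge[OF tail] y z] .
  then show ?case
    by (simp only: sum.atMost_Suc_shift)
qed

end

theorem lemma3p1:
  fixes \<nu> :: "'k::field \<Rightarrow> 'g::linordered_ab_group_add with_infty"
    and \<gamma> :: 'g and a b :: 'k and as :: "nat \<Rightarrow> 'k" and k :: nat
  assumes "valuation \<nu>" and "\<gamma> \<ge> 0"
  shows "(hclass \<nu> \<gamma> a = {a * (1 + u) | u. u \<in> m_ideal \<nu> (Fin \<gamma>)} \<and>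
         hclass \<nu> \<gamma> a = {x. val_gt \<nu> (x - a) (Fin \<gamma> + \<nu> a)}) \<and>
         (\<Union> (hadd \<nu> \<gamma> (hclass \<nu> \<gamma> a) (hclass \<nu> \<gamma> b))
           = {x. val_gt \<nu> (x - (a + b)) (Fin \<gamma> + min (\<nu> a) (\<nu> b))}) \<and>
         (0 \<in> \<Union> (hadd \<nu> \<gamma> (hclass \<nu> \<gamma> a) (hclass \<nu> \<gamma> b)) \<longleftrightarrow>
         \<Union> (hadd \<nu> \<gamma> (hclass \<nu> \<gamma> a) (hclass \<nu> \<gamma> b)) = m_ideal \<nu> (Fin \<gamma> + min (\<nu> a) (\<nu> b))) \<and>
         (hclass \<nu> \<gamma> (\<Sum>i\<le>k. as i) \<in> hsum \<nu> \<gamma> (\<lambda>i. hclass \<nu> \<gamma> (as i)) k) \<and>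
         ((\<forall>i\<le>k. as i \<in> valuation_ring \<nu>) \<longrightarrow>
         b \<in> \<Union> (hsum \<nu> \<gamma> (\<lambda>i. hclass \<nu> \<gamma> (as i)) k) \<longrightarrow>
         (\<exists>d\<in>m_ideal \<nu> (Fin \<gamma>). b = (\<Sum>i\<le>k. as i) + d))"
proof -
  interpret valued_field \<nu>
    using assms(1) by unfold_locales
  let ?\<delta> = "Fin \<gamma> + min (\<nu> a) (\<nu> b)"
  let ?U = "\<Union> (hadd \<nu> \<gamma> (hclass \<nu> \<gamma> a) (hclass \<nu> \<gamma> b))"
  have "hclass \<nu> \<gamma> a = {x. val_gt \<nu> (x - a) (Fin \<gamma> + \<nu> a)}"
    using mem_hclass_iff[of _ \<gamma> a] by (auto simp: m_ideal_def)
  moreover have "?U = {x. val_gt \<nu> (x - (a + b)) ?\<delta>}"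
    using Union_hadd_hclass[OF assms(2)] by (simp add: m_ideal_def)
  moreover have "0 \<in> ?U \<longleftrightarrow> ?U = m_ideal \<nu> ?\<delta>"
    unfolding Union_hadd_hclass[OF assms(2)] by (rule zero_mem_coset_m_ideal_iff)
  moreover have "\<exists>d\<in>m_ideal \<nu> (Fin \<gamma>). b = (\<Sum>i\<le>k. as i) + d"
    if "\<forall>i\<le>k. as i \<in> valuation_ring \<nu>"
      and "b \<in> \<Union> (hsum \<nu> \<gamma> (\<lambda>i. hclass \<nu> \<gamma> (as i)) k)"
  proof
    show "b - (\<Sum>i\<le>k. as i) \<in> m_ideal \<nu> (Fin \<gamma>)"
      using hsum_approx[OF assms(2), of k 0 as b] that
      by (simp only: valuation_ring_def mem_Collect_eq add_0_right)
    show "b = (\<Sum>i\<le>k. as i) + (b - (\<Sum>i\<le>k. as i))"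
      by simp
  qed
  ultimately show ?thesis
    using hclass_sum_mem_hsum[of \<gamma> as k] hclass_def[of \<nu> \<gamma> a] by blast
qed

end
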